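(* Let $A$ be a finite alphabet. The coloured non-commutative elementary symmetric functions satisfy, for all sentences $I,J$ over $A$, $$E_I\cdot E_J=E_{I\cdot J}$$ in $\mathrm{NSym}_A$. In particular, the elementary symmetric functions $E_I$ are generated by the single-word elementary functions $E_{(w)}$.
   Context: $\Bbbk$ is a field of characteristic zero. A sentence $I=(w_1,\dots,w_m)$ over $A$ is a finite sequence of non-empty words in letters of $A$; $1$ is the empty sentence. $\ell(I)=m$ is its length and $|I|=|w_1|+\dots+|w_m|$ its size (total number of letters). $I\cdot J$ is the concatenation of the two sequences of words. Write $J\preccurlyeq I$ ($J$ refines $I$) if the words of $I$ can be obtained by concatenating adjacent words of $J$. $\mathrm{NSym}_A$ is the $\Bbbk$-algebra with linear basis $(H_I)$ indexed by sentences over $A$, with product $H_I\cdot H_J=H_{I\cdot J}$ and unit $H_1=1$. The coloured non-commutative elementary symmetric functions are $$E_I=\sum_{J\preccurlyeq I}(-1)^{|I|-\ell(J)}H_J .$$ *)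

theory Defs
  imports Complex_Main "HOL-Library.Poly_Mapping"
begin

typedef 'a sentence = "{ws :: 'a list list. [] \<notin> set ws}"
  morphisms words Sentence
  by (rule exI[of _ "[]"]) simp

setup_lifting type_definition_sentence

text \<open>
  Sentences form a monoid under concatenation of sequences of words, with the empty
  sentence as unit.  It is written additively, although it is not commutative,
  because the convolution product on \<^typ>\<open>'m \<Rightarrow>\<^sub>0 'k\<close> expects an additive monoid.
\<close>

instantiation sentence :: (type) monoid_add
begin

lift_definition zero_sentence :: "'a sentence" is "[]" by simp

lift_definition plus_sentence :: "'a sentence \<Rightarrow> 'a sentence \<Rightarrow> 'a sentence" is "(@)" by simp

instance by standard (transfer; simp)+

end

definition sentences :: "'a set \<Rightarrow> 'a sentence set" where
  "sentences A = {I. \<forall>w\<in>set (words I). set w \<subseteq> A}"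

definition slength :: "'a sentence \<Rightarrow> nat" where
  "slength I = length (words I)"

definition ssize :: "'a sentence \<Rightarrow> nat" where
  "ssize I = (\<Sum>w\<leftarrow>words I. length w)"

text \<open>
  \<open>b\<close> lists the blocks of adjacent words of \<open>J\<close> that are joined to the words of \<open>I\<close>.
  No block is empty, as the words of \<open>I\<close> are non-empty.
\<close>

definition refines :: "'a sentence \<Rightarrow> 'a sentence \<Rightarrow> bool"  (infix \<open>\<preceq>\<^sub>r\<close> 50) where
  "J \<preceq>\<^sub>r I \<longleftrightarrow> (\<exists>b :: 'a list list list. concat b = words J \<and> map concat b = words I)"

text \<open>
  The linear combinations of all \<open>H\<^sub>I\<close>, for letters from the whole type \<open>'a\<close>, are the
  finitely supported functions \<^typ>\<open>'a sentence \<Rightarrow>\<^sub>0 'k\<close>; their library product is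
  the bilinear extension of \<open>H\<^sub>I \<cdot> H\<^sub>J = H\<^sub>I\<^sub>\<cdot>\<^sub>J\<close>.  For an alphabet \<open>A\<close>, which may be
  empty, NSym is the subalgebra of those supported on the sentences over \<open>A\<close>.
\<close>

definition NSym :: "'a set \<Rightarrow> ('a sentence \<Rightarrow>\<^sub>0 'k::field_char_0) set" where
  "NSym A = {f. Poly_Mapping.keys f \<subseteq> sentences A}"

definition nsym_H :: "'a sentence \<Rightarrow> ('a sentence \<Rightarrow>\<^sub>0 'k::field_char_0)" where
  "nsym_H I = Poly_Mapping.single I 1"

text \<open>
  The sum is finite (\<open>finite_refinements\<close>) and the exponent is not truncated
  (\<open>refines_imp_slength_le\<close>).
\<close>

definition nsym_E :: "'a sentence \<Rightarrow> ('a sentence \<Rightarrow>\<^sub>0 'k::field_char_0)" where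
  "nsym_E I = (\<Sum>J | J \<preceq>\<^sub>r I. (- 1) ^ (ssize I - slength J) * nsym_H J)"

definition is_subalgebra :: "('m::monoid_add \<Rightarrow>\<^sub>0 'k::field_char_0) set \<Rightarrow> bool" where
  "is_subalgebra B \<longleftrightarrow> 0 \<in> B \<and> 1 \<in> B \<and>
     (\<forall>f\<in>B. \<forall>g\<in>B. f + g \<in> B \<and> f * g \<in> B) \<and>
     (\<forall>c. \<forall>f\<in>B. Poly_Mapping.map ((*) c) f \<in> B)"

definition generated_subalgebra ::
    "('m::monoid_add \<Rightarrow>\<^sub>0 'k::field_char_0) set \<Rightarrow> ('m \<Rightarrow>\<^sub>0 'k) set" where
  "generated_subalgebra S = is_subalgebra hull S"


lemma nsym_H_mult: "nsym_H I * nsym_H J = nsym_H (I + J)"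
  by (simp add: nsym_H_def mult_single)

lemma nsym_H_zero: "nsym_H 0 = 1"
  by (simp add: nsym_H_def)

lemma length_le_sum_list_length: "[] \<notin> set ws \<Longrightarrow> length ws \<le> (\<Sum>w\<leftarrow>ws. length w)"
proof (induction ws)
  case (Cons w ws)
  then have "1 \<le> length w" "length ws \<le> (\<Sum>w\<leftarrow>ws. length w)"
    by (auto simp: Suc_le_eq)
  then have "1 + length ws \<le> length w + (\<Sum>w\<leftarrow>ws. length w)"
    by (rule add_mono)
  then show ?case by simp
qed simp

lemma slength_le_ssize: "slength J \<le> ssize J"
  using words[of J] length_le_sum_list_length unfolding slength_def ssize_def by blast

lemma refines_imp_concat_eq:
  assumes "J \<preceq>\<^sub>r I"
  shows "concat (words J) = concat (words I)"
proof -
  have "concat (concat b) = concat (map concat b)" for b :: "'a list list list"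
    by (induction b) auto
  with assms show ?thesis
    unfolding refines_def by metis
qed

lemma refines_imp_ssize_eq: "J \<preceq>\<^sub>r I \<Longrightarrow> ssize J = ssize I"
  unfolding ssize_def by (metis refines_imp_concat_eq length_concat)

lemma refines_imp_slength_le: "J \<preceq>\<^sub>r I \<Longrightarrow> slength J \<le> ssize I"
  using slength_le_ssize refines_imp_ssize_eq by metis

lemma set_words_subset_iff: "I \<in> sentences A \<longleftrightarrow> set (concat (words I)) \<subseteq> A"
  by (auto simp: sentences_def)

lemma refines_in_sentences: "J \<preceq>\<^sub>r I \<Longrightarrow> I \<in> sentences A \<Longrightarrow> J \<in> sentences A"
  by (metis set_words_subset_iff refines_imp_concat_eq)

lemma finite_refinements: "finite {J. J \<preceq>\<^sub>r I}"
proof -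
  let ?L = "set (concat (words I))"
  let ?W = "{w. set w \<subseteq> ?L \<and> length w \<le> ssize I}"
  let ?S = "{ws. set ws \<subseteq> ?W \<and> length ws \<le> ssize I}"
  have fin: "finite ?S"
    by (intro finite_lists_length_le) simp
  have "words ` {J. J \<preceq>\<^sub>r I} \<subseteq> ?S"
  proof clarify
    fix J assume J: "J \<preceq>\<^sub>r I"
    have "length w \<le> ssize J" if "w \<in> set (words J)" for w
      using that unfolding ssize_def by (simp add: member_le_sum_list)
    moreover have "set w \<subseteq> ?L" if "w \<in> set (words J)" for w
      using that refines_imp_concat_eq[OF J, symmetric] by auto
    ultimately show "set (words J) \<subseteq> ?W \<and> length (words J) \<le> ssize I"
      using refines_imp_ssize_eq[OF J] refines_imp_slength_le[OF J]
      by (auto simp: slength_def)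
  qed
  then have "finite (words ` {J. J \<preceq>\<^sub>r I})"
    using fin by (rule finite_subset)
  moreover have "inj_on words {J. J \<preceq>\<^sub>r I}"
    by (simp add: inj_on_def words_inject)
  ultimately show ?thesis
    by (rule finite_imageD)
qed

end

theory Submission
  imports Defs
begin

text \<open>
  Concatenation is a bijection from the pairs of a refinement of \<open>I\<close> and a refinement of \<open>J\<close>
  to the refinements of \<open>I \<cdot> J\<close>: the blocks split at the boundary between \<open>I\<close> and \<open>J\<close>, and the
  cut is unique because a refinement of \<open>I\<close> has exactly the letters of \<open>I\<close> and no word is empty.
  Size and length are additive, so the signs multiply.
\<close>

lemma words_zero: "words 0 = []"
  by transfer simp

lemma words_plus: "words (I + J) = words I @ words J"
  by transfer simp

lemma ssize_plus: "ssize (I + J) = ssize I + ssize J"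
  by (simp add: ssize_def words_plus)

lemma slength_plus: "slength (I + J) = slength I + slength J"
  by (simp add: slength_def words_plus)

lemma words_Sentence: "[] \<notin> set ws \<Longrightarrow> words (Sentence ws) = ws"
  by (simp add: Sentence_inverse)

text \<open>Of two prefixes of the same list one extends the other by some \<open>us\<close>. Equal
  letters force \<open>concat us = []\<close>, and as no word is empty, \<open>us\<close> itself is
  empty.\<close>

lemma append_eq_append_nonempty_words:
  assumes "xs @ ys = zs @ ts" and "concat xs = concat zs"
    and "[] \<notin> set xs" and "[] \<notin> set zs"
  shows "xs = zs \<and> ys = ts"
proof -
  obtain us where "xs = zs @ us \<and> us @ ys = ts \<or> xs @ us = zs \<and> ys = us @ ts"
    using assms(1) by (auto simp: append_eq_append_conv2)
  moreover from this have "us = []"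
    using assms(2-4) by (cases us) auto
  ultimately show ?thesis by auto
qed

lemma refines_plus:
  assumes "K \<preceq>\<^sub>r I" and "L \<preceq>\<^sub>r J"
  shows "K + L \<preceq>\<^sub>r I + J"
proof -
  obtain b c where "concat b = words K" "map concat b = words I"
    "concat c = words L" "map concat c = words J"
    using assms unfolding refines_def by blast
  then show ?thesis
    unfolding refines_def by (intro exI[of _ "b @ c"]) (simp add: words_plus)
qed

text \<open>The list of blocks that join to the words of \<open>I + J\<close> is cut after the
  blocks belonging to \<open>I\<close>; flattening the two halves gives \<open>K\<close> and
  \<open>L\<close>.\<close>

lemma refines_plusE:
  assumes "M \<preceq>\<^sub>r I + J"
  obtains K L where "K \<preceq>\<^sub>r I" "L \<preceq>\<^sub>r J" "M = K + L"
proof -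
  obtain b where b: "concat b = words M" "map concat b = words I @ words J"
    using assms unfolding refines_def words_plus by blast
  obtain c d where cd: "b = c @ d" "map concat c = words I" "map concat d = words J"
    using b(2) by (auto simp: map_eq_append_conv)
  have split: "concat c @ concat d = words M"
    using b(1) cd(1) by simp
  \<comment> \<open>\<open>words\<close> inverts \<open>Sentence\<close> only on lists without empty
    words; both halves inherit this from \<open>M\<close>.\<close>
  then have "[] \<notin> set (concat c @ concat d)"
    using words[of M] by simp
  then have ws: "words (Sentence (concat c)) = concat c" "words (Sentence (concat d)) = concat d"
    by (simp_all only: set_append Un_iff words_Sentence not_False_eq_True de_Morgan_disj)
  show thesis
  proof
    show "Sentence (concat c) \<preceq>\<^sub>r I" "Sentence (concat d) \<preceq>\<^sub>r J"
      unfolding refines_def ws using cd by blast+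
    show "M = Sentence (concat c) + Sentence (concat d)"
      by (simp only: words_inject[symmetric] words_plus ws split)
  qed
qed

lemma bij_betw_refines_plus:
  "bij_betw (\<lambda>(K, L). K + L) ({K. K \<preceq>\<^sub>r I} \<times> {L. L \<preceq>\<^sub>r J}) {M. M \<preceq>\<^sub>r I + J}"
proof (rule bij_betw_imageI)
  show "inj_on (\<lambda>(K, L). K + L) ({K. K \<preceq>\<^sub>r I} \<times> {L. L \<preceq>\<^sub>r J})"
  proof (rule inj_onI, clarify)
    fix K L K' L'
    assume K: "K \<preceq>\<^sub>r I" "K' \<preceq>\<^sub>r I" and eq: "K + L = K' + L'"
    have "words K @ words L = words K' @ words L'"
      using eq by (metis words_plus)
    moreover have "concat (words K) = concat (words K')"
      using K by (simp add: refines_imp_concat_eq)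
    ultimately have "words K = words K' \<and> words L = words L'"
      using words[of K] words[of K'] by (intro append_eq_append_nonempty_words) auto
    then show "K = K' \<and> L = L'"
      by (simp add: words_inject)
  qed
  show "(\<lambda>(K, L). K + L) ` ({K. K \<preceq>\<^sub>r I} \<times> {L. L \<preceq>\<^sub>r J}) = {M. M \<preceq>\<^sub>r I + J}"
    by (auto intro: refines_plus elim!: refines_plusE)
qed

text \<open>The convolution product is not commutative, but signs are central: each power is
  \<open>1\<close> or \<open>- 1\<close>.\<close>

lemma minus_one_power_mult_mult:
  fixes x y :: "'r::ring_1"
  shows "((- 1) ^ m * x) * ((- 1) ^ n * y) = (- 1) ^ (m + n) * (x * y)"
  by (simp add: minus_one_power_iff)

lemma nsym_E_plus:
  "nsym_E (I + J) = (nsym_E I * nsym_E J :: 'a sentence \<Rightarrow>\<^sub>0 'k::field_char_0)"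
proof -
  let ?t = "\<lambda>I K. (- 1) ^ (ssize I - slength K) * nsym_H K :: 'a sentence \<Rightarrow>\<^sub>0 'k"
  let ?R = "{K. K \<preceq>\<^sub>r I} \<times> {L. L \<preceq>\<^sub>r J}"
  have summand: "?t (I + J) (K + L) = ?t I K * ?t J L" if "K \<preceq>\<^sub>r I" "L \<preceq>\<^sub>r J" for K L
  proof -
    \<comment> \<open>Subtraction on naturals splits here because neither difference is truncated: a
      refinement has at most as many words as the refined sentence has letters.\<close>
    have "ssize (I + J) - slength (K + L) = (ssize I - slength K) + (ssize J - slength L)"
      using that[THEN refines_imp_slength_le] by (simp add: ssize_plus slength_plus)
    then show ?thesis
      by (simp only: minus_one_power_mult_mult nsym_H_mult)
  qed
  have "nsym_E (I + J) = (\<Sum>(K, L)\<in>?R. ?t (I + J) (K + L))"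
    unfolding nsym_E_def
    by (subst sum.reindex_bij_betw[OF bij_betw_refines_plus, symmetric]) (simp add: case_prod_unfold)
  also have "\<dots> = (\<Sum>(K, L)\<in>?R. ?t I K * ?t J L)"
    using summand by (intro sum.cong) auto
  also have "\<dots> = nsym_E I * nsym_E J"
    unfolding nsym_E_def by (simp only: sum_product sum.cartesian_product)
  finally show ?thesis .
qed

lemma refines_zero_iff: "J \<preceq>\<^sub>r 0 \<longleftrightarrow> J = 0"
  by (auto simp: refines_def words_zero words_inject[symmetric])

lemma nsym_E_zero: "nsym_E 0 = 1"
  by (simp add: nsym_E_def refines_zero_iff nsym_H_zero ssize_def words_zero)

text \<open>Refining keeps the letters, and a sign does not change the support of
  \<open>nsym_H J\<close>, so every summand is supported on sentences over \<open>A\<close>.\<close>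

lemma nsym_E_in_NSym:
  assumes "I \<in> sentences A"
  shows "(nsym_E I :: 'a sentence \<Rightarrow>\<^sub>0 'k::field_char_0) \<in> NSym A"
proof -
  have "Poly_Mapping.keys ((- 1) ^ n * nsym_H J :: 'a sentence \<Rightarrow>\<^sub>0 'k) \<subseteq> sentences A"
    if "J \<preceq>\<^sub>r I" for n J
    using refines_in_sentences[OF that assms] by (simp add: minus_one_power_iff nsym_H_def)
  then show ?thesis
    unfolding NSym_def nsym_E_def
    by (blast dest: subsetD[OF Poly_Mapping.keys_sum])
qed

text \<open>The closure conditions survive arbitrary intersections, so the hull satisfies them
  too.\<close>

lemma is_subalgebra_generated_subalgebra: "is_subalgebra (generated_subalgebra S)"
  unfolding generated_subalgebra_def
  by (rule hull_in) (auto simp: is_subalgebra_def)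

text \<open>By multiplicativity, \<open>nsym_E I\<close> is the product of the generators for the
  single words of \<open>I\<close>; the empty product is \<open>1\<close>, which lies in every
  subalgebra.\<close>

lemma nsym_E_in_generated_subalgebra:
  assumes "I \<in> sentences A"
  shows "(nsym_E I :: 'a sentence \<Rightarrow>\<^sub>0 'k::field_char_0) \<in>
    generated_subalgebra {nsym_E S | S. S \<in> sentences A \<and> slength S = 1}"
    (is "_ \<in> ?G")
proof -
  have sub: "is_subalgebra ?G"
    by (rule is_subalgebra_generated_subalgebra)
  \<comment> \<open>The induction runs over the underlying list of words, splitting off the first
    word; the premise on \<open>[]\<close> ensures that \<open>Sentence ws\<close> has exactly the
    words \<open>ws\<close>.\<close>
  have "(nsym_E (Sentence ws) :: 'a sentence \<Rightarrow>\<^sub>0 'k) \<in> ?G"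
    if "[] \<notin> set ws" "Sentence ws \<in> sentences A" for ws
    using that
  proof (induction ws)
    case Nil
    have "nsym_E (Sentence []) = (1 :: 'a sentence \<Rightarrow>\<^sub>0 'k)"
      by (simp add: nsym_E_zero flip: zero_sentence_def)
    then show ?case using sub by (simp add: is_subalgebra_def)
  next
    case (Cons w ws)
    have ws: "words (Sentence [w]) = [w]" "words (Sentence ws) = ws"
      "words (Sentence (w # ws)) = w # ws"
      using Cons.prems(1) by (simp_all add: words_Sentence)
    have split: "Sentence (w # ws) = Sentence [w] + Sentence ws"
      by (simp add: words_inject[symmetric] words_plus ws)
    have "Sentence [w] \<in> sentences A" "Sentence ws \<in> sentences A"
      using Cons.prems(2) by (auto simp: sentences_def ws)
    moreover from this have "(nsym_E (Sentence [w]) :: 'a sentence \<Rightarrow>\<^sub>0 'k) \<in> ?G"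
      unfolding generated_subalgebra_def by (intro hull_inc) (auto simp: slength_def ws)
    ultimately show ?case
      using sub Cons by (simp add: split nsym_E_plus is_subalgebra_def)
  qed
  from this[of "words I"] show ?thesis
    using words[of I] assms by (simp add: words_inverse)
qed

theorem proposition3p8:
  fixes A :: "'a set"
  assumes "finite A"
  shows "(\<forall>I\<in>sentences A. \<forall>J\<in>sentences A.
           (nsym_E I :: 'a sentence \<Rightarrow>\<^sub>0 'k::field_char_0) \<in> NSym A \<and>
           (nsym_E J :: 'a sentence \<Rightarrow>\<^sub>0 'k) \<in> NSym A \<and>
           (nsym_E I * nsym_E J :: 'a sentence \<Rightarrow>\<^sub>0 'k) = nsym_E (I + J)) \<and>
         (\<forall>I\<in>sentences A.
           (nsym_E I :: 'a sentence \<Rightarrow>\<^sub>0 'k) \<in>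
             generated_subalgebra {nsym_E S | S. S \<in> sentences A \<and> slength S = 1})"
  by (intro conjI ballI nsym_E_in_NSym nsym_E_in_generated_subalgebra nsym_E_plus[symmetric])

end
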